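(* Let $f\in\mathcal H$ and $j\in\{1,\dots,N\}$. The coefficients $c_n^{N-1}$, $n=1,\dots,j-1,j+1,\dots,N$, of the linear expansion $$f_{\tilde V_{N-1}}=\sum_{n=1,\,n\neq j}^N c_n^{N-1}\alpha_n$$ which minimizes the distance $\|f-g\|$ over all $g\in\tilde V_{N-1}$ are obtained from $c_n^N$ and $\beta_n^N$, $n=1,\dots,N$, by $$c_n^{N-1}=c_n^N-\frac{\langle\beta_n^N,\beta_j^N\rangle}{\|\beta_j^N\|^2}\,c_j^N,\qquad n=1,\dots,j-1,j+1,\dots,N.$$
   Context: $\mathcal H$ is a (real or complex) Hilbert space with inner product $\langle\cdot,\cdot\rangle$, linear in its second argument (and conjugate-linear in the first in the complex case), and norm $\|\cdot\|$. Let $N\ge 1$ and let $\alpha_1,\dots,\alpha_N\in\mathcal H$ be linearly independent (not necessarily orthogonal) vectors, called atoms, with $V_N=\operatorname{span}\{\alpha_1,\dots,\alpha_N\}$. Let $\beta_1^N,\dots,\beta_N^N\in V_N$ be the dual (biorthogonal) atoms, i.e. the vectors of $V_N$ with $\langle\alpha_n,\beta_m^N\rangle=\delta_{n,m}$ for all $n,m$; they give the orthogonal projector $\hat P_{V_N}$ onto $V_N$ by $\hat P_{V_N}g=\sum_{n=1}^N\alpha_n\langle\beta_n^N,g\rangle$ for $g\in\mathcal H$. For the signal $f\in\mathcal H$, put $c_n^N=\langle\beta_n^N,f\rangle$, so that $\hat P_{V_N}f=\sum_{n=1}^N c_n^N\alpha_n$. For the index $j$, $\tilde V_{N-1}=\operatorname{span}\{\alpha_1,\dots,\alpha_{j-1},\alpha_{j+1},\dots,\alpha_N\}$.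 *)

theory Defs
  imports "HOL-Analysis.Analysis"
begin

text \<open>
  Scalars of a real or complex Hilbert space. By Gelfand--Mazur a \<open>real_normed_field\<close> is
  isomorphic to the reals or the complex numbers, and the second axiom forces
  \<open>conjg\<close> to be the identity or complex conjugation, respectively.
\<close>

class rc_field = real_normed_field +
  fixes conjg :: "'a \<Rightarrow> 'a"
  assumes conjg_add: "conjg (x + y) = conjg x + conjg y"
    and conjg_mult_self: "conjg x * x = ((norm x)\<^sup>2) *\<^sub>R 1"

instantiation real :: rc_field
begin
definition conjg_real :: "real \<Rightarrow> real" where "conjg_real x = x"
instance by standard (simp_all add: conjg_real_def power2_eq_square)
end

instantiation complex :: rc_field
begin
definition conjg_complex :: "complex \<Rightarrow> complex" where "conjg_complex = cnj"
instance
  by standard (simp_all add: conjg_complex_def complex_norm_square scaleR_conv_of_real mult.commute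
      del: of_real_power)
end

text \<open>
  The inner product is linear in its second argument. Positivity and definiteness follow from
  \<open>ip_self\<close>, and completeness is part of the sort \<open>banach\<close>. The axiom \<open>scale_of_real\<close> makes the
  real vector space underlying \<open>banach\<close> the restriction of scalars of \<open>scale\<close>.
\<close>

locale hilbert_space = vector_space scale
  for scale :: "'k::rc_field \<Rightarrow> 'v::banach \<Rightarrow> 'v" +
  fixes ip :: "'v \<Rightarrow> 'v \<Rightarrow> 'k"
  assumes scale_of_real: "scale (of_real r) x = r *\<^sub>R x"
    and ip_add_right: "ip x (y + z) = ip x y + ip x z"
    and ip_scale_right: "ip x (scale a y) = a * ip x y"
    and ip_commute: "ip y x = conjg (ip x y)"
    and ip_self: "ip x x = of_real ((norm x)\<^sup>2)"

lemma hilbert_space_real_inner: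
  "hilbert_space scaleR (inner :: 'v::{real_inner,banach} \<Rightarrow> 'v \<Rightarrow> real)"
  by unfold_locales
    (simp_all add: conjg_real_def inner_commute power2_norm_eq_inner algebra_simps)

lemma hilbert_space_complex:
  "hilbert_space (*) (\<lambda>x y :: complex. cnj x * y)"
  by unfold_locales
    (simp_all add: conjg_complex_def complex_norm_square scaleR_conv_of_real algebra_simps
      del: of_real_power)

end

theory Submission
  imports Defs
begin

text \<open>
  Write \<open>P g = (\<Sum>n. \<langle>\<beta> n, g\<rangle> \<alpha> n)\<close> for the projector onto the span \<open>V\<close> of the atoms, and \<open>W\<close> for the
  span of the atoms other than \<open>\<alpha> j\<close>. By biorthogonality \<open>\<beta> j\<close> is a vector of \<open>V\<close> orthogonal to \<open>W\<close>,
  so that it spans the orthogonal complement of \<open>W\<close> in \<open>V\<close>. Hence the point of \<open>W\<close> closest to \<open>f\<close>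
  is \<open>P f\<close> with its component along \<open>\<beta> j\<close> removed, which is
  \<open>p = P f - (c j / \<parallel>\<beta> j\<parallel>\<^sup>2) \<beta> j\<close>. Because \<open>\<beta> j = P (\<beta> j)\<close>, the coefficient of \<open>p\<close> at \<open>\<alpha> n\<close>
  is \<open>c n - (\<langle>\<beta> n, \<beta> j\<rangle> / \<parallel>\<beta> j\<parallel>\<^sup>2) c j\<close>. It vanishes at \<open>n = j\<close>, which shows \<open>p \<in> W\<close>.

  The proof rests on two facts. A residual orthogonal to \<open>W\<close> characterises the unique best
  approximation (\<open>is_arg_min_iff_eq_orthogonal\<close>, by Pythagoras), and \<open>g - P g\<close> is orthogonal to
  every atom (\<open>ip_atom_expansion\<close>). The second one holds since each atom is a combination of the
  dual atoms, with the entries of the Gram matrix as coefficients. The coefficients themselves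
  are recovered from a vector by pairing it with the dual atoms, so that the minimiser determines
  them.
\<close>

section \<open>Sesquilinearity and orthogonality\<close>

lemma conjg_0: "conjg (0 :: 'a::rc_field) = 0"
  using conjg_add[of "0::'a" 0] by simp

text \<open>
  Conjugation is multiplicative because \<open>conjg x = \<parallel>x\<parallel>\<^sup>2 / x\<close> for \<open>x \<noteq> 0\<close>, and the norm is.
\<close>

lemma conjg_mult: "conjg (x * y) = conjg x * conjg (y :: 'a::rc_field)"
proof (cases "x = 0 \<or> y = 0")
  case True
  then show ?thesis by (auto simp: conjg_0)
next
  case False
  have "conjg (x * y) * (x * y) = (conjg x * x) * (conjg y * y)"
    by (simp add: conjg_mult_self norm_mult power_mult_distrib)
  also have "\<dots> = (conjg x * conjg y) * (x * y)"
    by (simp add: algebra_simps)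
  finally show ?thesis
    using False by simp
qed

lemma conjg_1: "conjg (1 :: 'a::rc_field) = 1"
  using conjg_mult_self[of "1::'a"] by simp

context hilbert_space
begin

lemma ip_zero_right: "ip x 0 = 0"
  using ip_add_right[of x 0 0] by simp

lemma ip_diff_right: "ip x (y - z) = ip x y - ip x z"
  using ip_add_right[of x "y - z" z] by simp

lemma ip_sum_right: "ip x (\<Sum>i\<in>A. g i) = (\<Sum>i\<in>A. ip x (g i))"
  by (induction A rule: infinite_finite_induct) (simp_all add: ip_zero_right ip_add_right)

lemma ip_add_left: "ip (x + y) z = ip x z + ip y z"
  by (metis conjg_add ip_add_right ip_commute)

lemma ip_zero_left: "ip 0 x = 0"
  using ip_add_left[of 0 0 x] by simp

lemma ip_scale_left: "ip (scale a x) y = conjg a * ip x y"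
  by (metis conjg_mult ip_commute ip_scale_right)

lemma ip_sum_left: "ip (\<Sum>i\<in>A. g i) x = (\<Sum>i\<in>A. ip (g i) x)"
  by (induction A rule: infinite_finite_induct) (simp_all add: ip_zero_left ip_add_left)

lemma ip_self_eq_0_iff: "ip x x = 0 \<longleftrightarrow> x = 0"
  by (simp add: ip_self)

lemma orthogonal_sym: "ip x y = 0 \<Longrightarrow> ip y x = 0"
  by (metis ip_commute conjg_0)

lemma orthogonal_span:
  assumes "\<And>s. s \<in> S \<Longrightarrow> ip s v = 0" and "w \<in> span S"
  shows "ip w v = 0"
  using assms(2)
  by (induction rule: span_induct_alt)
    (simp_all add: ip_zero_left ip_add_left ip_scale_left assms(1))

lemma orthogonal_in_span_eq_0:
  assumes "v \<in> span S" and "\<And>s. s \<in> S \<Longrightarrow> ip s v = 0"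
  shows "v = 0"
  using orthogonal_span[OF assms(2) assms(1)] by (simp add: ip_self_eq_0_iff)

lemma norm_add_orthogonal:
  assumes "ip x y = 0"
  shows "(norm (x + y))\<^sup>2 = (norm x)\<^sup>2 + (norm y)\<^sup>2"
proof -
  have "ip (x + y) (x + y) = ip x x + ip y y"
    by (simp add: ip_add_left ip_add_right assms orthogonal_sym[OF assms])
  then have "(of_real ((norm (x + y))\<^sup>2) :: 'k) = of_real ((norm x)\<^sup>2 + (norm y)\<^sup>2)"
    by (simp only: ip_self of_real_add)
  then show ?thesis
    by (simp only: of_real_eq_iff)
qed

text \<open>
  By Pythagoras, moving from \<open>p\<close> to another point \<open>q\<close> of the subspace adds \<open>\<parallel>p - q\<parallel>\<^sup>2\<close> to the squared
  distance from \<open>f\<close>. So \<open>p\<close> is the only minimiser.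
\<close>

lemma is_arg_min_iff_eq_orthogonal:
  assumes p: "p \<in> span S" and orth: "\<And>s. s \<in> S \<Longrightarrow> ip s (f - p) = 0"
  shows "is_arg_min (\<lambda>g. norm (f - g)) (\<lambda>g. g \<in> span S) q \<longleftrightarrow> q = p"
proof -
  have dist: "(norm (f - g))\<^sup>2 = (norm (f - p))\<^sup>2 + (norm (p - g))\<^sup>2" if "g \<in> span S" for g
  proof -
    have "ip (p - g) (f - p) = 0"
      using orthogonal_span[OF orth] p that by (simp add: span_diff)
    from norm_add_orthogonal[OF orthogonal_sym[OF this]] show ?thesis
      by simp
  qed
  have le: "norm (f - p) \<le> norm (f - g)" if "g \<in> span S" for g
    by (rule power2_le_imp_le) (simp_all add: dist[OF that])
  have less: "norm (f - p) < norm (f - g)" if "g \<in> span S" "g \<noteq> p" for g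
    by (rule power2_less_imp_less) (use that in \<open>simp_all add: dist\<close>)
  show ?thesis
    unfolding is_arg_min_def using p le less by (meson not_less)
qed

section \<open>Expansions in a biorthogonal system\<close>

lemma sum_atoms_in_span: "(\<Sum>n\<in>I. scale (a n) (\<alpha> n)) \<in> span (\<alpha> ` I)"
  by (intro span_sum span_scale span_base) blast

lemma ip_dual_sum_atoms:
  assumes "finite I" and "m \<in> I"
    and "\<And>n. n \<in> I \<Longrightarrow> ip (\<alpha> n) (\<beta> m) = (if n = m then 1 else 0)"
  shows "ip (\<beta> m) (\<Sum>n\<in>I. scale (a n) (\<alpha> n)) = a m"
proof -
  have "ip (\<beta> m) (\<alpha> n) = (if n = m then 1 else 0)" if "n \<in> I" for n
    using assms(3)[OF that] ip_commute[of "\<beta> m" "\<alpha> n"] by (simp add: conjg_0 conjg_1)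
  then have "ip (\<beta> m) (\<Sum>n\<in>I. scale (a n) (\<alpha> n)) = (\<Sum>n\<in>I. if n = m then a n else 0)"
    unfolding ip_sum_right by (intro sum.cong) (simp_all add: ip_scale_right)
  then show ?thesis
    using assms(1,2) by simp
qed

lemma sum_atoms_eq_iff:
  assumes "finite I"
    and "\<And>n m. n \<in> I \<Longrightarrow> m \<in> I \<Longrightarrow> ip (\<alpha> n) (\<beta> m) = (if n = m then 1 else 0)"
  shows "(\<Sum>n\<in>I. scale (a n) (\<alpha> n)) = (\<Sum>n\<in>I. scale (b n) (\<alpha> n)) \<longleftrightarrow> (\<forall>n\<in>I. a n = b n)"
proof
  assume eq: "(\<Sum>n\<in>I. scale (a n) (\<alpha> n)) = (\<Sum>n\<in>I. scale (b n) (\<alpha> n))"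
  show "\<forall>n\<in>I. a n = b n"
  proof
    fix m assume m: "m \<in> I"
    have rec: "ip (\<beta> m) (\<Sum>n\<in>I. scale (x n) (\<alpha> n)) = x m" for x
      using assms(1) m assms(2)[OF _ m] by (rule ip_dual_sum_atoms)
    from rec[of a] rec[of b] eq show "a m = b m"
      by simp
  qed
qed (simp cong: sum.cong)

text \<open>
  The difference of the two sides lies in the span of the atoms, and every atom pairs with it to
  \<open>0\<close> by biorthogonality, so it vanishes. The dual atoms therefore span the same space as the atoms.
\<close>

lemma expansion_dual_atoms:
  assumes "finite I"
    and dual: "\<And>n. n \<in> I \<Longrightarrow> \<beta> n \<in> span (\<alpha> ` I)"
    and biorth: "\<And>n m. n \<in> I \<Longrightarrow> m \<in> I \<Longrightarrow> ip (\<alpha> n) (\<beta> m) = (if n = m then 1 else 0)"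
    and v: "v \<in> span (\<alpha> ` I)"
  shows "v = (\<Sum>n\<in>I. scale (ip (\<alpha> n) v) (\<beta> n))"
proof -
  let ?w = "v - (\<Sum>n\<in>I. scale (ip (\<alpha> n) v) (\<beta> n))"
  have "ip (\<alpha> m) ?w = 0" if "m \<in> I" for m
  proof -
    have "ip (\<alpha> m) (\<Sum>n\<in>I. scale (ip (\<alpha> n) v) (\<beta> n))
        = (\<Sum>n\<in>I. if m = n then ip (\<alpha> n) v else 0)"
      by (simp add: ip_sum_right ip_scale_right biorth that if_distrib cong: if_cong sum.cong)
    also have "\<dots> = ip (\<alpha> m) v"
      using assms(1) that by simp
    finally show ?thesis
      by (simp add: ip_diff_right)
  qed
  moreover have "?w \<in> span (\<alpha> ` I)"
    by (intro span_diff span_sum span_scale v dual)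
  ultimately have "?w = 0"
    by (intro orthogonal_in_span_eq_0[of ?w "\<alpha> ` I"]) auto
  then show ?thesis
    by simp
qed

text \<open>
  This says that \<open>g\<close> minus its expansion is orthogonal to every atom. The pairing with \<open>\<alpha> m\<close> is
  computed by expanding \<open>\<alpha> m\<close> in the dual atoms; the coefficient \<open>\<langle>\<alpha> n, \<alpha> m\<rangle>\<close> leaves the first
  argument conjugated, as \<open>\<langle>\<alpha> m, \<alpha> n\<rangle>\<close>.
\<close>

lemma ip_atom_expansion:
  assumes "finite I"
    and "\<And>n. n \<in> I \<Longrightarrow> \<beta> n \<in> span (\<alpha> ` I)"
    and "\<And>n m. n \<in> I \<Longrightarrow> m \<in> I \<Longrightarrow> ip (\<alpha> n) (\<beta> m) = (if n = m then 1 else 0)"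
    and "m \<in> I"
  shows "ip (\<alpha> m) (\<Sum>n\<in>I. scale (ip (\<beta> n) g) (\<alpha> n)) = ip (\<alpha> m) g"
proof -
  have "\<alpha> m \<in> span (\<alpha> ` I)"
    using assms(4) by (intro span_base) blast
  from expansion_dual_atoms[OF assms(1-3) this]
  have "ip (\<alpha> m) g = ip (\<Sum>n\<in>I. scale (ip (\<alpha> n) (\<alpha> m)) (\<beta> n)) g"
    by simp
  also have "\<dots> = (\<Sum>n\<in>I. ip (\<alpha> m) (\<alpha> n) * ip (\<beta> n) g)"
    by (simp add: ip_sum_left ip_scale_left flip: ip_commute)
  also have "\<dots> = ip (\<alpha> m) (\<Sum>n\<in>I. scale (ip (\<beta> n) g) (\<alpha> n))"
    by (simp add: ip_sum_right ip_scale_right mult.commute)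
  finally show ?thesis ..
qed

lemma expansion_atoms:
  assumes "finite I"
    and "\<And>n. n \<in> I \<Longrightarrow> \<beta> n \<in> span (\<alpha> ` I)"
    and "\<And>n m. n \<in> I \<Longrightarrow> m \<in> I \<Longrightarrow> ip (\<alpha> n) (\<beta> m) = (if n = m then 1 else 0)"
    and "v \<in> span (\<alpha> ` I)"
  shows "(\<Sum>n\<in>I. scale (ip (\<beta> n) v) (\<alpha> n)) = v"
proof -
  have "v - (\<Sum>n\<in>I. scale (ip (\<beta> n) v) (\<alpha> n)) = 0"
    by (rule orthogonal_in_span_eq_0[of _ "\<alpha> ` I"])
      (auto simp: ip_diff_right ip_atom_expansion[OF assms(1-3)]
        intro: span_diff assms(4) sum_atoms_in_span)
  then show ?thesis
    by simp
qed

section \<open>Deleting one atom\<close>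

text \<open>
  Subtracting from the projection of \<open>f\<close> its component along \<open>\<beta> j\<close> cancels the coefficient at
  \<open>\<alpha> j\<close>, so that the sum on the left may skip \<open>j\<close>.
\<close>

lemma sum_reduced_coefficients:
  assumes "finite I"
    and "\<And>n. n \<in> I \<Longrightarrow> \<beta> n \<in> span (\<alpha> ` I)"
    and biorth: "\<And>n m. n \<in> I \<Longrightarrow> m \<in> I \<Longrightarrow> ip (\<alpha> n) (\<beta> m) = (if n = m then 1 else 0)"
    and j: "j \<in> I"
  shows "(\<Sum>n\<in>I - {j}. scale (ip (\<beta> n) f - ip (\<beta> n) (\<beta> j) / of_real ((norm (\<beta> j))\<^sup>2) * ip (\<beta> j) f) (\<alpha> n))
    = (\<Sum>n\<in>I. scale (ip (\<beta> n) f) (\<alpha> n)) - scale (ip (\<beta> j) f / of_real ((norm (\<beta> j))\<^sup>2)) (\<beta> j)"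
    (is "(\<Sum>n\<in>I - {j}. scale (?a n) (\<alpha> n)) = ?Pf - scale ?t (\<beta> j)")
proof -
  have "\<beta> j \<noteq> 0"
    using biorth[OF j j] by (auto simp: ip_zero_right)
  then have "?a j = 0"
    by (simp add: ip_self)
  then have "(\<Sum>n\<in>I - {j}. scale (?a n) (\<alpha> n)) = (\<Sum>n\<in>I. scale (?a n) (\<alpha> n))"
    using assms(1) j by (simp add: sum.remove)
  also have "\<dots> = (\<Sum>n\<in>I. scale (ip (\<beta> n) f) (\<alpha> n) - scale ?t (scale (ip (\<beta> n) (\<beta> j)) (\<alpha> n)))"
    by (simp add: scale_left_diff_distrib mult.commute)
  also have "\<dots> = ?Pf - scale ?t (\<Sum>n\<in>I. scale (ip (\<beta> n) (\<beta> j)) (\<alpha> n))"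
    by (simp add: sum_subtractf scale_sum_right)
  finally show ?thesis
    using expansion_atoms[OF assms(1-3) assms(2)[OF j]] by simp
qed

end

theorem lemma2:
  fixes scale :: "'k::rc_field \<Rightarrow> 'v::banach \<Rightarrow> 'v"
    and ip :: "'v \<Rightarrow> 'v \<Rightarrow> 'k"
    and N j :: nat
    and \<alpha> \<beta> :: "nat \<Rightarrow> 'v"
    and c d :: "nat \<Rightarrow> 'k"
    and f :: 'v
  assumes hilbert: "hilbert_space scale ip"
    and N: "N \<ge> 1"
    and distinct_atoms: "inj_on \<alpha> {1..N}"
    and independent_atoms: "\<not> module.dependent scale (\<alpha> ` {1..N})"
    and dual_in_span: "\<And>n. n \<in> {1..N} \<Longrightarrow> \<beta> n \<in> module.span scale (\<alpha> ` {1..N})"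
    and biorthogonal: "\<And>n m. n \<in> {1..N} \<Longrightarrow> m \<in> {1..N} \<Longrightarrow>
      ip (\<alpha> n) (\<beta> m) = (if n = m then 1 else 0)"
    and coefficients: "\<And>n. n \<in> {1..N} \<Longrightarrow> c n = ip (\<beta> n) f"
    and j: "j \<in> {1..N}"
  shows "is_arg_min (\<lambda>g. norm (f - g)) (\<lambda>g. g \<in> module.span scale (\<alpha> ` ({1..N} - {j})))
           (\<Sum>n\<in>{1..N} - {j}. scale (d n) (\<alpha> n))
     \<longleftrightarrow> (\<forall>n\<in>{1..N} - {j}.
           d n = c n - ip (\<beta> n) (\<beta> j) / of_real ((norm (\<beta> j))\<^sup>2) * c j)"
proof -
  interpret hilbert_space scale ip
    by (rule hilbert)
  let ?I = "{1..N}"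
  let ?a = "\<lambda>n. c n - ip (\<beta> n) (\<beta> j) / of_real ((norm (\<beta> j))\<^sup>2) * c j"
  let ?p = "\<Sum>n\<in>?I - {j}. scale (?a n) (\<alpha> n)"
  let ?q = "\<Sum>n\<in>?I - {j}. scale (d n) (\<alpha> n)"
  have p: "?p = (\<Sum>n\<in>?I. scale (ip (\<beta> n) f) (\<alpha> n))
      - scale (ip (\<beta> j) f / of_real ((norm (\<beta> j))\<^sup>2)) (\<beta> j)"
  proof -
    have "?p = (\<Sum>n\<in>?I - {j}. scale
        (ip (\<beta> n) f - ip (\<beta> n) (\<beta> j) / of_real ((norm (\<beta> j))\<^sup>2) * ip (\<beta> j) f) (\<alpha> n))"
      by (intro sum.cong refl) (simp add: coefficients coefficients[OF j])
    then show ?thesis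
      using sum_reduced_coefficients[OF _ dual_in_span biorthogonal j, of f] by simp
  qed
  have "ip (\<alpha> m) (f - ?p) = 0" if "m \<in> ?I - {j}" for m
  proof -
    have "ip (\<alpha> m) (\<Sum>n\<in>?I. scale (ip (\<beta> n) f) (\<alpha> n)) = ip (\<alpha> m) f"
      using that by (intro ip_atom_expansion dual_in_span biorthogonal) auto
    moreover have "ip (\<alpha> m) (\<beta> j) = 0"
      using that j by (simp add: biorthogonal)
    ultimately show ?thesis
      unfolding p by (simp add: ip_diff_right ip_scale_right)
  qed
  then have "is_arg_min (\<lambda>g. norm (f - g)) (\<lambda>g. g \<in> span (\<alpha> ` (?I - {j}))) ?q \<longleftrightarrow> ?q = ?p"
    by (intro is_arg_min_iff_eq_orthogonal sum_atoms_in_span) blast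
  also have "\<dots> \<longleftrightarrow> (\<forall>n\<in>?I - {j}. d n = ?a n)"
    by (rule sum_atoms_eq_iff[where \<beta> = \<beta>]) (auto simp: biorthogonal)
  finally show ?thesis .
qed

end
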